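(* Let $m\in\mathbb{N}$ be odd, $n\in\mathbb{N}_0$ and $\alpha,\lambda\in\mathbb{C}$. Then $$G_{n}^{(\alpha)}(mx;\lambda)=m^{n-\alpha}\sum_{v_{1},v_{2},\dots,v_{m-1}\geq 0}\binom{\alpha}{v_{1},v_{2},\dots,v_{m-1}}(-\lambda)^{r}\,G_{n}^{(\alpha)}\Big(x+\frac{r}{m};\lambda^{m}\Big),$$ where $r=v_{1}+2v_{2}+\dots+(m-1)v_{m-1}$ and the sum runs over all tuples of nonnegative integers $(v_1,\dots,v_{m-1})$.
   Context: The Apostol-Genocchi polynomials of order $\alpha$ are defined by the generating function $\Big(\frac{2z}{\lambda e^{z}+1}\Big)^{\alpha}e^{xz}=\sum_{n=0}^{\infty}G_{n}^{(\alpha)}(x;\lambda)\frac{z^{n}}{n!}$. For complex $\alpha$ and nonnegative integers $v_1,\dots,v_{m-1}$ the generalized multinomial coefficient is $\binom{\alpha}{v_1,\dots,v_{m-1}}=\frac{\alpha(\alpha-1)\cdots(\alpha-(v_1+\dots+v_{m-1})+1)}{v_1!\cdots v_{m-1}!}$, i.e. the coefficient of $y_1^{v_1}\cdots y_{m-1}^{v_{m-1}}$ in $(1+y_1+\dots+y_{m-1})^{\alpha}$.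
   Formalization: The identity is asserted when the sum over all tuples converges (proved for α∈ℕ₀ or |λ|+…+|λ|^{m-1}<1; e.g. λ=-1, α=1/2, m=3 diverges). If α∉ℕ₀ and λ≠-1, where no power series exists, G_n is n! times the z^n coefficient in powers z^{α+k}, so 0 for non-integral α. *)

theory Defs
  imports
    "HOL-Analysis.Analysis"
    "HOL-Computational_Algebra.Formal_Power_Series"
begin

text \<open>
  The base \<open>2z / (l e\<^sup>z + 1)\<close> of the generating function, as a formal power series; \<open>l\<close> is the
  parameter usually written \<open>\<lambda>\<close>. The division of power series cancels the common factor \<open>z\<close>
  if \<open>l = -1\<close>, where the constant term is \<open>-2\<close>; otherwise the series starts with \<open>2z / (l + 1)\<close>.
\<close>

definition genocchi_base :: "complex \<Rightarrow> complex fps" where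
  "genocchi_base l = (fps_const 2 * fps_X) / (fps_const l * fps_exp 1 + 1)"

text \<open>
  \<open>U\<^sup>a = c\<^sup>a (1 + (U/c - 1))\<^sup>a\<close> for a series \<open>U\<close> with constant term \<open>c \<noteq> 0\<close>: the second factor is
  expanded binomially and \<open>c\<^sup>a\<close> is the principal power.
\<close>

definition fps_cpow :: "complex fps \<Rightarrow> complex \<Rightarrow> complex fps" where
  "fps_cpow U a = fps_const (fps_nth U 0 powr a) *
     fps_compose (fps_binomial a) (fps_const (inverse (fps_nth U 0)) * U - 1)"

text \<open>
  Write the base as \<open>z\<^sup>d U(z)\<close> with \<open>U(0) \<noteq> 0\<close>. The generating function is
  \<open>z\<^bsup>d a\<^esup> U(z)\<^sup>a e\<^bsup>x z\<^esup>\<close>, an expansion in the powers \<open>z\<^bsup>k + d a\<^esup>\<close> with \<open>k = 0, 1, 2, \<dots>\<close>, and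
  \<open>apostol_genocchi a n x l\<close> is \<open>n!\<close> times its coefficient at \<open>z\<^sup>n\<close>. The index set of the sum below
  has at most one element; the coefficient is 0 if the power \<open>z\<^sup>n\<close> does not occur.
  If \<open>a\<close> is a natural number or \<open>l = -1\<close>, the generating function is a formal power series
  (lemmas \<open>apostol_genocchi_gf_of_nat\<close> and \<open>apostol_genocchi_gf_minus_one\<close>). For other \<open>a\<close> it is
  \<open>z\<^sup>a\<close> times a power series: a Laurent series if \<open>a\<close> is a negative integer, and
  without any integral power of \<open>z\<close> if \<open>a\<close> is not an integer.
\<close>

definition apostol_genocchi :: "complex \<Rightarrow> nat \<Rightarrow> complex \<Rightarrow> complex \<Rightarrow> complex" where
  "apostol_genocchi a n x l =
     fact n * (\<Sum>k | of_nat k + of_nat (subdegree (genocchi_base l)) * a = (of_nat n :: complex).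
       fps_nth (fps_cpow (unit_factor (genocchi_base l)) a * fps_exp x) k)"

definition gen_multinomial :: "complex \<Rightarrow> 'i set \<Rightarrow> ('i \<Rightarrow> nat) \<Rightarrow> complex" where
  "gen_multinomial a I v = (\<Prod>j<sum v I. a - of_nat j) / (\<Prod>i\<in>I. fact (v i))"

lemma genocchi_denom_nonzero: "fps_const l * fps_exp 1 + 1 \<noteq> (0 :: complex fps)"
proof
  assume eq: "fps_const l * fps_exp 1 + 1 = (0 :: complex fps)"
  have "fps_nth (fps_const l * fps_exp 1 + 1) 0 = 0" "fps_nth (fps_const l * fps_exp 1 + 1) 1 = 0"
    unfolding eq by simp_all
  then show False by simp
qed

lemma genocchi_base_mult:
  "genocchi_base l * (fps_const l * fps_exp 1 + 1) = fps_const 2 * fps_X"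
proof -
  let ?D = "fps_const l * fps_exp 1 + 1 :: complex fps"
  have "subdegree ?D \<le> 1"
  proof (rule ccontr)
    assume "\<not> subdegree ?D \<le> 1"
    then have "fps_nth ?D 0 = 0" "fps_nth ?D 1 = 0"
      using nth_less_subdegree_zero[of 0 ?D] nth_less_subdegree_zero[of 1 ?D] by linarith+
    then show False by simp
  qed
  moreover have "subdegree (fps_const 2 * fps_X :: complex fps) = 1"
    by (rule subdegreeI) auto
  ultimately have "?D dvd fps_const 2 * fps_X"
    using genocchi_denom_nonzero[of l] by (subst fps_dvd_iff) auto
  then show ?thesis unfolding genocchi_base_def by (rule dvd_div_mult_self)
qed

lemma genocchi_base_nonzero: "genocchi_base l \<noteq> 0"
  using genocchi_base_mult[of l] by auto

lemma subdegree_genocchi_base: "subdegree (genocchi_base l) = (if l = -1 then 0 else 1)"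
proof -
  let ?D = "fps_const l * fps_exp 1 + 1 :: complex fps"
  have "subdegree (genocchi_base l) + subdegree ?D = subdegree (genocchi_base l * ?D)"
    using genocchi_base_nonzero genocchi_denom_nonzero by simp
  also have "\<dots> = 1" unfolding genocchi_base_mult by (rule subdegreeI) auto
  moreover have "subdegree ?D = (if l = -1 then 1 else 0)"
    by (auto intro!: subdegreeI simp: eq_neg_iff_add_eq_0)
  ultimately show ?thesis by (auto split: if_splits)
qed

lemma fps_cpow_of_nat:
  assumes "fps_nth U 0 \<noteq> 0"
  shows "fps_cpow U (of_nat k) = U ^ k"
proof -
  let ?c = "fps_nth U 0"
  let ?V = "fps_const (inverse ?c) * U - 1"
  have V0: "fps_nth ?V 0 = 0" using assms by simp
  have "fps_compose (fps_binomial (of_nat k)) ?V = (1 + ?V) ^ k"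
    unfolding fps_binomial_of_nat fps_compose_power[OF V0, symmetric]
    using V0 by (simp add: fps_compose_add_distrib fps_X_fps_compose_startby0[OF V0])
  also have "\<dots> = fps_const (inverse ?c ^ k) * U ^ k"
    by (simp add: power_mult_distrib fps_const_power)
  finally show ?thesis
    using assms unfolding fps_cpow_def
    by (simp add: powr_nat mult.assoc[symmetric] power_mult_distrib[symmetric])
qed

lemma apostol_genocchi_gf_of_nat:
  "Abs_fps (\<lambda>n. apostol_genocchi (of_nat k) n x l / fact n) = genocchi_base l ^ k * fps_exp x"
proof (rule fps_ext)
  fix n
  let ?F = "genocchi_base l"
  let ?d = "subdegree ?F"
  let ?H = "unit_factor ?F ^ k * fps_exp x"
  have pow: "fps_cpow (unit_factor ?F) (of_nat k) = unit_factor ?F ^ k"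
    by (rule fps_cpow_of_nat) (rule fps_unit_factor_nth_0[OF genocchi_base_nonzero])
  have idx: "{j. of_nat j + of_nat ?d * of_nat k = (of_nat n :: complex)} =
      (if n < ?d * k then {} else {n - ?d * k})"
    unfolding of_nat_mult[symmetric] of_nat_add[symmetric] of_nat_eq_iff by auto
  have "?F ^ k * fps_exp x = (unit_factor ?F * fps_X ^ ?d) ^ k * fps_exp x"
    by (simp only: fps_unit_factor_decompose[symmetric])
  also have "\<dots> = fps_X ^ (?d * k) * ?H"
    by (simp only: power_mult_distrib power_mult[symmetric] ac_simps)
  finally show "fps_nth (Abs_fps (\<lambda>n. apostol_genocchi (of_nat k) n x l / fact n)) n =
      fps_nth (?F ^ k * fps_exp x) n"
    by (simp add: apostol_genocchi_def pow idx fps_X_power_mult_nth mult.assoc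
          del: fps_unit_factor_def of_nat_mult)
qed

lemma apostol_genocchi_gf_minus_one:
  "Abs_fps (\<lambda>n. apostol_genocchi a n x (-1) / fact n) = fps_cpow (genocchi_base (-1)) a * fps_exp x"
  by (rule fps_ext) (simp add: apostol_genocchi_def subdegree_genocchi_base)

end

theory Submission
  imports Defs "HOL-Computational_Algebra.Fundamental_Theorem_Algebra"
begin

text \<open>
  Put \<open>y\<^sub>i = (-l)\<^sup>i e\<^bsup>i z / m\<^esup>\<close> and \<open>T = y\<^sub>1 + \<dots> + y\<^sub>m\<^sub>-\<^sub>1\<close>. As \<open>m\<close> is odd, the geometric sum gives
  \<open>1 + T = (1 + l\<^sup>m e\<^sup>z) / (1 + l e\<^bsup>z / m\<^esup>)\<close>, so multiplication by \<open>1 + T\<close> turns the base of the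
  generating function with parameter \<open>l\<^sup>m\<close> into \<open>m\<close> times the base with parameter \<open>l\<close> at \<open>z / m\<close>.
  The multinomial expansion of \<open>(1 + T)\<^sup>a\<close>, summed coefficient by coefficient, gives the identity
  if \<open>a\<close> is a natural number, and also if \<open>a\<close> is a negative integer and the series converges
  (\<open>\<bar>l\<bar> + \<dots> + \<bar>l\<bar>\<^bsup>m-1\<^esup> < 1\<close>).
  For other \<open>a\<close>, both sides vanish unless \<open>l\<^sup>m = -1\<close>. When \<open>l\<^sup>m = -1\<close> and \<open>m > 1\<close>, or when \<open>a\<close> is a negative
  integer and the above sum is at least 1, the series diverges: its terms contain a nonzero
  polynomial in \<open>r\<close>, which stays away from 0 for large \<open>r\<close>, so convergence would force
  \<open>\<bar>a gchoose k\<bar> (\<bar>l\<bar> + \<dots> + \<bar>l\<bar>\<^bsup>m-1\<^esup>)\<^sup>k\<close> to tend to 0.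
\<close>

section \<open>Tuples of fixed total degree and the multinomial theorem\<close>

text \<open>Extensional functions represent each tuple exactly once, so a layer of total degree
  \<open>k\<close> is finite for finite \<open>I\<close>, and the layers partition the index set of
  the theorem.\<close>

definition exponents :: "'i set \<Rightarrow> nat \<Rightarrow> ('i \<Rightarrow> nat) set" where
  "exponents I k = {v \<in> I \<rightarrow>\<^sub>E UNIV. sum v I = k}"

lemma finite_exponents:
  assumes "finite I"
  shows "finite (exponents I k)"
proof (rule finite_subset)
  show "exponents I k \<subseteq> I \<rightarrow>\<^sub>E {..k}"
  proof
    fix v assume v: "v \<in> exponents I k"
    then have "v i \<le> k" if "i \<in> I" for i
      using member_le_sum[of i I v] that assms by (auto simp: exponents_def)
    with v show "v \<in> I \<rightarrow>\<^sub>E {..k}" by (auto simp: exponents_def PiE_iff)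
  qed
qed (use assms in \<open>simp add: finite_PiE\<close>)

lemma sum_exponents_insert:
  assumes "finite I" "a \<notin> I"
  shows "(\<Sum>v\<in>exponents (insert a I) k. f v) =
         (\<Sum>j\<le>k. \<Sum>v\<in>exponents I (k - j). f (v(a := j)))"
proof -
  have "(\<Sum>v\<in>exponents (insert a I) k. f v) =
      (\<Sum>p\<in>(SIGMA j:{..k}. exponents I (k - j)). f ((snd p)(a := fst p)))"
  proof (rule sum.reindex_bij_witness[of _ "\<lambda>p. (snd p)(a := fst p)"
        \<comment> \<open>Resetting the removed coordinate to \<open>undefined\<close> keeps the
          remaining tuple extensional on \<open>I\<close>.\<close>
        "\<lambda>v. (v a, v(a := undefined))"], goal_cases)
    case (1 v)
    then show ?case by simp
  next
    case (2 v)
    have "sum (v(a := undefined)) I = sum v I"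
      by (intro sum.cong) (use assms in auto)
    with 2 show ?case
      using assms by (auto simp: exponents_def intro: fun_upd_in_PiE)
  next
    case (3 p)
    then have "(snd p) a = undefined"
      using assms by (auto simp: exponents_def PiE_def extensional_def)
    then show ?case by (cases p) (auto simp: fun_upd_idem)
  next
    case (4 p)
    have "sum ((snd p)(a := fst p)) I = sum (snd p) I"
      by (intro sum.cong) (use assms in auto)
    with 4 show ?case
      using assms by (auto simp: exponents_def intro!: PiE_fun_upd)
  next
    case (5 v)
    then show ?case by simp
  qed
  also have "\<dots> = (\<Sum>j\<le>k. \<Sum>v\<in>exponents I (k - j). f (v(a := j)))"
    by (subst sum.Sigma) (auto simp: finite_exponents assms case_prod_beta)
  finally show ?thesis .
qed

text \<open>Divided by \<open>fact k\<close>, the multinomial weights factor over \<open>I\<close>.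
  Splitting off the exponent \<open>j\<close> of one index therefore reduces the induction step to
  the binomial theorem.\<close>

lemma multinomial_theorem_fps:
  fixes y :: "'i \<Rightarrow> 'a::field_char_0 fps"
  assumes "finite I"
  shows "(\<Sum>v\<in>exponents I k. fps_const (inverse (\<Prod>i\<in>I. fact (v i))) * (\<Prod>i\<in>I. y i ^ v i)) =
         fps_const (inverse (fact k)) * (\<Sum>i\<in>I. y i) ^ k"
  using assms
proof (induction I arbitrary: k rule: finite_induct)
  case empty
  have "exponents ({} :: 'i set) k = (if k = 0 then {\<lambda>_. undefined} else {})"
    by (auto simp: exponents_def)
  then show ?case by simp
next
  case (insert a I)
  let ?Y = "\<Sum>i\<in>I. y i"
  have "(\<Sum>v\<in>exponents (insert a I) k.
           fps_const (inverse (\<Prod>i\<in>insert a I. fact (v i))) * (\<Prod>i\<in>insert a I. y i ^ v i)) =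
        (\<Sum>j\<le>k. \<Sum>v\<in>exponents I (k - j). fps_const (inverse (fact j)) * y a ^ j *
           (fps_const (inverse (\<Prod>i\<in>I. fact (v i))) * (\<Prod>i\<in>I. y i ^ v i)))"
  proof (subst sum_exponents_insert[OF insert.hyps], intro sum.cong refl)
    fix j v
    have eq: "(\<Prod>i\<in>I. fact ((v(a := j)) i)) = (\<Prod>i\<in>I. fact (v i) :: 'a)"
      "(\<Prod>i\<in>I. y i ^ (v(a := j)) i) = (\<Prod>i\<in>I. y i ^ v i)"
      using insert.hyps by (auto intro!: prod.cong)
    show "fps_const (inverse (\<Prod>i\<in>insert a I. fact ((v(a := j)) i))) *
            (\<Prod>i\<in>insert a I. y i ^ (v(a := j)) i) =
          fps_const (inverse (fact j)) * y a ^ j *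
           (fps_const (inverse (\<Prod>i\<in>I. fact (v i))) * (\<Prod>i\<in>I. y i ^ v i))"
      unfolding prod.insert[OF insert.hyps] eq
      by (simp add: fps_const_mult[symmetric] mult_ac del: fps_const_mult)
  qed
  also have "\<dots> = (\<Sum>j\<le>k. fps_const (inverse (fact j)) * y a ^ j *
      (fps_const (inverse (fact (k - j))) * ?Y ^ (k - j)))"
    by (simp only: sum_distrib_left[symmetric] insert.IH)
  also have "\<dots> = (\<Sum>j\<le>k. fps_const (inverse (fact k)) *
      (of_nat (k choose j) * y a ^ j * ?Y ^ (k - j)))"
  proof (intro sum.cong refl)
    fix j assume "j \<in> {..k}"
    then have "inverse (fact j) * inverse (fact (k - j)) =
        (inverse (fact k) * of_nat (k choose j) :: 'a)"
      by (simp add: binomial_fact divide_inverse)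
    then have "fps_const (inverse (fact j)) * fps_const (inverse (fact (k - j))) =
        fps_const (inverse (fact k)) * (of_nat (k choose j) :: 'a fps)"
      by (simp add: fps_of_nat[symmetric])
    then show "fps_const (inverse (fact j)) * y a ^ j *
      (fps_const (inverse (fact (k - j))) * ?Y ^ (k - j)) = fps_const (inverse (fact k)) *
      (of_nat (k choose j) * y a ^ j * ?Y ^ (k - j))"
      by (metis (no_types, lifting) mult.assoc mult.left_commute)
  qed
  also have "\<dots> = fps_const (inverse (fact k)) * (y a + ?Y) ^ k"
    by (simp only: sum_distrib_left[symmetric] binomial_ring)
  finally show ?case using insert.hyps by simp
qed

text \<open>Separates the dependence on \<open>a\<close>, which enters only through the total
  degree, from an ordinary multinomial coefficient.\<close>

lemma gen_multinomial_eq_gbinomial: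
  "gen_multinomial a I v =
     (a gchoose sum v I) * fact (sum v I) * inverse (\<Prod>i\<in>I. fact (v i))"
  by (simp add: gen_multinomial_def gbinomial_mult_fact' divide_inverse lessThan_atLeast0)

lemma sum_gen_multinomial_fps:
  assumes "finite I"
  shows "(\<Sum>v\<in>exponents I k. fps_const (gen_multinomial a I v) * (\<Prod>i\<in>I. y i ^ v i)) =
         fps_const (a gchoose k) * (\<Sum>i\<in>I. y i) ^ k"
proof -
  have "(\<Sum>v\<in>exponents I k. fps_const (gen_multinomial a I v) * (\<Prod>i\<in>I. y i ^ v i)) =
      (\<Sum>v\<in>exponents I k. fps_const ((a gchoose k) * fact k) *
         (fps_const (inverse (\<Prod>i\<in>I. fact (v i))) * (\<Prod>i\<in>I. y i ^ v i)))"
    by (intro sum.cong refl)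
      (simp add: exponents_def gen_multinomial_eq_gbinomial mult.assoc[symmetric] del: of_nat_fact)
  also have "\<dots> = fps_const ((a gchoose k) * fact k) *
      (fps_const (inverse (fact k)) * (\<Sum>i\<in>I. y i) ^ k)"
    by (simp only: sum_distrib_left[symmetric] multinomial_theorem_fps[OF assms])
  finally show ?thesis by (simp add: mult.assoc[symmetric])
qed

lemma fps_prod_nth_0: "fps_nth (\<Prod>i\<in>A. f i) 0 = (\<Prod>i\<in>A. fps_nth (f i) 0)"
  for f :: "'i \<Rightarrow> 'a::comm_ring_1 fps"
  by (induction A rule: infinite_finite_induct) auto

text \<open>On one layer the norms differ from ordinary multinomial coefficients by the constant
  factor \<open>norm (a gchoose k)\<close>. The resulting layer sums decide both convergence and
  divergence.\<close>

lemma sum_norm_gen_multinomial: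
  assumes "finite I"
  shows "(\<Sum>v\<in>exponents I k. norm (gen_multinomial a I v) * (\<Prod>i\<in>I. q i ^ v i)) =
         norm (a gchoose k) * (\<Sum>i\<in>I. q i :: real) ^ k"
proof -
  \<comment> \<open>Real weights are embedded as constant series, so that the multinomial theorem
    can be read off at coefficient 0.\<close>
  have *: "fps_nth (fps_const c * (\<Prod>i\<in>I. fps_const (q i) ^ v i)) 0 = c * (\<Prod>i\<in>I. q i ^ v i)"
    for c and v :: "'a \<Rightarrow> nat"
    by (simp add: fps_prod_nth_0)
  have "(\<Sum>v\<in>exponents I k. norm (gen_multinomial a I v) * (\<Prod>i\<in>I. q i ^ v i)) =
      (\<Sum>v\<in>exponents I k. norm (a gchoose k) * fact k *
         fps_nth (fps_const (inverse (\<Prod>i\<in>I. fact (v i))) * (\<Prod>i\<in>I. fps_const (q i) ^ v i)) 0)"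
    unfolding *
    by (intro sum.cong refl)
      (simp add: exponents_def gen_multinomial_eq_gbinomial norm_mult norm_inverse prod_norm[symmetric])
  also have "\<dots> = norm (a gchoose k) * fact k *
      fps_nth (fps_const (inverse (fact k)) * (\<Sum>i\<in>I. fps_const (q i)) ^ k) 0"
    by (simp only: sum_distrib_left[symmetric] fps_sum_nth[symmetric] multinomial_theorem_fps[OF assms])
  also have "\<dots> = norm (a gchoose k) * (\<Sum>i\<in>I. q i) ^ k"
    by (simp add: fps_sum_nth fps_power_zeroth)
  finally show ?thesis .
qed

section \<open>Sums over all tuples, grouped by total degree\<close>

lemma bij_betw_exponents:
  "bij_betw snd (SIGMA k:UNIV. exponents I k) (I \<rightarrow>\<^sub>E UNIV)"
  by (rule bij_betwI[where g = "\<lambda>v. (sum v I, v)"]) (auto simp: exponents_def)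

lemma has_sum_exponents:
  fixes f :: "('i \<Rightarrow> nat) \<Rightarrow> 'a :: {topological_comm_monoid_add,t3_space}"
  assumes "finite I" "(f has_sum S) (I \<rightarrow>\<^sub>E UNIV)"
  shows "(\<lambda>k. \<Sum>v\<in>exponents I k. f v) sums S"
proof -
  have "((\<lambda>p. f (snd p)) has_sum S) (SIGMA k:UNIV. exponents I k)"
    using assms(2) has_sum_reindex_bij_betw[OF bij_betw_exponents] by blast
  then have "((\<lambda>k. \<Sum>v\<in>exponents I k. f v) has_sum S) UNIV"
    by (rule has_sum_SigmaD) (simp add: finite_exponents assms)
  then show ?thesis by (rule has_sum_imp_sums)
qed

text \<open>A converse to grouping: nonnegativity excludes cancellation inside and between
  layers.\<close>

lemma summable_on_exponents:
  fixes f :: "('i \<Rightarrow> nat) \<Rightarrow> real"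
  assumes "finite I" "\<And>v. v \<in> I \<rightarrow>\<^sub>E UNIV \<Longrightarrow> f v \<ge> 0"
    and "summable (\<lambda>k. \<Sum>v\<in>exponents I k. f v)"
  shows "f summable_on (I \<rightarrow>\<^sub>E UNIV)"
proof -
  have pos: "f v \<ge> 0" if "v \<in> exponents I k" for v k
    using that assms(2) by (auto simp: exponents_def)
  have "(\<lambda>k. \<Sum>v\<in>exponents I k. f v) summable_on UNIV"
    by (rule summable_nonneg_imp_summable_on) (auto intro!: sum_nonneg pos assms(3))
  then have "(\<lambda>p. f (snd p)) summable_on (SIGMA k:UNIV. exponents I k)"
    by (intro summable_on_SigmaI[where g = "\<lambda>k. \<Sum>v\<in>exponents I k. f v"])
      (auto simp: finite_exponents assms pos)
  then show ?thesis
    using summable_on_reindex_bij_betw[OF bij_betw_exponents] by blast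
qed

section \<open>Absolute convergence of the multinomial series\<close>

lemma power_div_fact_le_exp: "x ^ n / fact n \<le> exp x" if "x \<ge> 0" for x :: real
proof -
  have "(\<Sum>k\<in>{n}. inverse (fact k) * x ^ k) \<le> exp x"
    unfolding exp_def real_scaleR_def
    using summable_exp[of x] that by (intro sum_le_suminf) auto
  then show ?thesis by (simp add: field_simps)
qed

lemma prod_fps_exp_power:
  fixes q :: "'i \<Rightarrow> 'a::field_char_0"
  assumes "finite I"
  shows "(\<Prod>i\<in>I. (fps_const (q i) * fps_exp (b i)) ^ v i) =
    fps_const (\<Prod>i\<in>I. q i ^ v i) * fps_exp (\<Sum>i\<in>I. of_nat (v i) * b i)"
  using assms
  by (induction I rule: finite_induct)
    (simp_all add: power_mult_distrib fps_const_power fps_exp_power_mult fps_exp_add_mult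
      fps_const_mult[symmetric] mult_ac del: fps_const_mult)

text \<open>For \<open>a = n\<close> the factor \<open>a gchoose k\<close> vanishes for
  \<open>k > n\<close>, so only finitely many layers, each finite, contribute, whatever
  \<open>c\<close> is.\<close>

lemma abs_summable_multinomial_of_nat:
  assumes "finite I" "a \<in> \<nat>"
  shows "(\<lambda>v. norm (gen_multinomial a I v * c v)) summable_on (I \<rightarrow>\<^sub>E UNIV)"
proof (rule summable_on_exponents[OF assms(1)])
  obtain n where n: "a = of_nat n" using assms(2) by (auto elim: Nats_cases)
  show "summable (\<lambda>k. \<Sum>v\<in>exponents I k. norm (gen_multinomial a I v * c v))"
  proof (rule summable_finite[of "{..n}"])
    fix k assume "k \<notin> {..n}"
    then show "(\<Sum>v\<in>exponents I k. norm (gen_multinomial a I v * c v)) = 0"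
      by (intro sum.neutral) (auto simp: gen_multinomial_eq_gbinomial exponents_def n
          binomial_gbinomial[symmetric])
  qed simp
qed simp

text \<open>The layer sums are the absolute terms of the binomial series at the sum of the weights,
  a point inside its disc of convergence.\<close>

lemma abs_summable_multinomial_lt_1:
  fixes q :: "'i \<Rightarrow> real"
  assumes "finite I" and "(\<Sum>i\<in>I. q i) < 1" and "\<And>i. i \<in> I \<Longrightarrow> q i \<ge> 0"
  shows "(\<lambda>v. norm (gen_multinomial a I v) * (\<Prod>i\<in>I. q i ^ v i)) summable_on (I \<rightarrow>\<^sub>E UNIV)"
proof (rule summable_on_exponents[OF assms(1)])
  let ?s = "\<Sum>i\<in>I. q i"
  have s: "0 \<le> ?s" "?s < 1" using assms by (auto intro: sum_nonneg)
  have "summable (\<lambda>k. norm ((a gchoose k) * of_real ?s ^ k))"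
    by (rule abs_summable_in_conv_radius) (use s in \<open>auto simp: conv_radius_gchoose simp del: of_real_sum\<close>)
  then show "summable (\<lambda>k. \<Sum>v\<in>exponents I k. norm (gen_multinomial a I v) * (\<Prod>i\<in>I. q i ^ v i))"
    using s by (simp add: sum_norm_gen_multinomial[OF assms(1)] norm_mult norm_power del: of_real_sum)
qed (auto intro!: mult_nonneg_nonneg prod_nonneg zero_le_power assms(3))

lemma abs_summable_multinomial_exp_sum:
  fixes q b :: "'i \<Rightarrow> complex"
  assumes "finite I" and "a \<in> \<nat> \<or> (\<Sum>i\<in>I. norm (q i)) < 1"
  shows "(\<lambda>v. norm (gen_multinomial a I v *
           ((\<Prod>i\<in>I. q i ^ v i) * (\<Sum>i\<in>I. of_nat (v i) * b i) ^ j))) summable_on (I \<rightarrow>\<^sub>E UNIV)"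
proof (cases "a \<in> \<nat>")
  case True
  then show ?thesis by (rule abs_summable_multinomial_of_nat[OF assms(1)])
next
  case False
  \<comment> \<open>The polynomial factor is absorbed into slightly larger weights, as \<open>u\<^sup>j \<le> j! \<rho>\<^bsup>-j\<^esup> e\<^bsup>\<rho> u\<^esup>\<close>.\<close>
  let ?Q = "\<lambda>\<rho>. \<Sum>i\<in>I. norm (q i) * exp (\<rho> * norm (b i))"
  \<comment> \<open>At \<open>\<rho> = 0\<close> the enlarged weights sum to less than 1; by
    continuity this persists for some \<open>\<rho> > 0\<close>.\<close>
  have "(?Q \<longlongrightarrow> ?Q 0) (at_right 0)"
    by (intro tendsto_intros)
  then have "eventually (\<lambda>\<rho>. ?Q \<rho> < 1) (at_right 0)"
    by (rule order_tendstoD) (use assms False in simp)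
  then have "eventually (\<lambda>\<rho>. ?Q \<rho> < 1 \<and> \<rho> > 0) (at_right 0)"
    using eventually_at_right_less[of 0] by (rule eventually_conj)
  then obtain \<rho> where \<rho>: "?Q \<rho> < 1" "\<rho> > 0"
    using eventually_happens' trivial_limit_at_right_real by blast
  define p where "p i = norm (q i) * exp (\<rho> * norm (b i))" for i
  have "(\<lambda>v. norm (gen_multinomial a I v) * (\<Prod>i\<in>I. p i ^ v i)) summable_on (I \<rightarrow>\<^sub>E UNIV)"
    by (rule abs_summable_multinomial_lt_1) (use assms \<rho> in \<open>simp_all add: p_def\<close>)
  then have "(\<lambda>v. fact j / \<rho> ^ j * (norm (gen_multinomial a I v) * (\<Prod>i\<in>I. p i ^ v i)))
      summable_on (I \<rightarrow>\<^sub>E UNIV)"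
    by (rule summable_on_cmult_right)
  then show ?thesis
  proof (rule Infinite_Sum.abs_summable_on_comparison_test')
    fix v :: "'i \<Rightarrow> nat"
    let ?b = "\<Sum>i\<in>I. of_nat (v i) * b i" and ?B = "\<Sum>i\<in>I. of_nat (v i) * norm (b i)"
    have "norm ?b \<le> ?B"
      by (rule order_trans[OF norm_sum]) (simp add: norm_mult)
    then have "norm (?b ^ j) \<le> ?B ^ j"
      by (simp add: norm_power power_mono)
    also have "\<dots> = fact j / \<rho> ^ j * ((\<rho> * ?B) ^ j / fact j)"
      using \<rho> by (simp add: power_mult_distrib)
    also have "\<dots> \<le> fact j / \<rho> ^ j * exp (\<rho> * ?B)"
      using \<rho> by (intro mult_left_mono power_div_fact_le_exp) (auto intro!: mult_nonneg_nonneg sum_nonneg)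
    also have "exp (\<rho> * ?B) = (\<Prod>i\<in>I. exp (\<rho> * norm (b i)) ^ v i)"
      by (simp add: sum_distrib_left exp_sum assms exp_of_nat_mult[symmetric] mult_ac)
    finally have "norm (?b ^ j) \<le> fact j / \<rho> ^ j * (\<Prod>i\<in>I. exp (\<rho> * norm (b i)) ^ v i)" .
    then have "norm (gen_multinomial a I v) * (\<Prod>i\<in>I. norm (q i) ^ v i) * norm (?b ^ j) \<le>
        norm (gen_multinomial a I v) * (\<Prod>i\<in>I. norm (q i) ^ v i) *
        (fact j / \<rho> ^ j * (\<Prod>i\<in>I. exp (\<rho> * norm (b i)) ^ v i))"
      by (intro mult_left_mono) (auto intro!: mult_nonneg_nonneg prod_nonneg)
    then show "norm (gen_multinomial a I v * ((\<Prod>i\<in>I. q i ^ v i) * ?b ^ j)) \<le>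
        fact j / \<rho> ^ j * (norm (gen_multinomial a I v) * (\<Prod>i\<in>I. p i ^ v i))"
      by (simp add: norm_mult norm_power prod_norm[symmetric] p_def power_mult_distrib
          prod.distrib mult_ac)
  qed
qed

section \<open>The binomial series of a sum of exponentials\<close>

text \<open>
  The series for \<open>(1 + T)\<^sup>a\<close> with \<open>T\<close> having a possibly nonzero constant term, so that composition of
  formal power series does not apply and each coefficient is an infinite series.
\<close>

definition binomial_series :: "complex \<Rightarrow> complex fps \<Rightarrow> complex fps" where
  "binomial_series a T = Abs_fps (\<lambda>j. \<Sum>k. (a gchoose k) * fps_nth (T ^ k) j)"

definition exp_sum :: "'i set \<Rightarrow> ('i \<Rightarrow> complex) \<Rightarrow> ('i \<Rightarrow> complex) \<Rightarrow> complex fps" where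
  "exp_sum I q b = (\<Sum>i\<in>I. fps_const (q i) * fps_exp (b i))"

text \<open>Absolute convergence over tuples permits grouping by degree, and each layer collapses by
  the multinomial theorem to one term of the binomial series. The second claim feeds the recursion
  in \<open>a\<close>.\<close>

lemma has_sum_multinomial_exp_sum:
  fixes q b :: "'i \<Rightarrow> complex"
  assumes "finite I" and "a \<in> \<nat> \<or> (\<Sum>i\<in>I. norm (q i)) < 1"
  defines "f \<equiv> \<lambda>v j. gen_multinomial a I v *
       ((\<Prod>i\<in>I. q i ^ v i) * fps_nth (fps_exp (\<Sum>i\<in>I. of_nat (v i) * b i)) j)"
  shows "((\<lambda>v. f v j) has_sum fps_nth (binomial_series a (exp_sum I q b)) j) (I \<rightarrow>\<^sub>E UNIV)"
    and "summable (\<lambda>k. (a gchoose k) * fps_nth (exp_sum I q b ^ k) j)"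
proof -
  have "(\<lambda>v. norm (f v j)) summable_on (I \<rightarrow>\<^sub>E UNIV)"
    using summable_on_cmult_right[OF abs_summable_multinomial_exp_sum[OF assms(1,2), of b j],
        of "inverse (fact j)"]
    by (simp add: f_def norm_mult norm_power norm_divide norm_fact divide_inverse mult_ac norm_inverse)
  then have "(\<lambda>v. f v j) summable_on (I \<rightarrow>\<^sub>E UNIV)"
    by (rule abs_summable_summable)
  then have sum: "((\<lambda>v. f v j) has_sum (\<Sum>\<^sub>\<infinity>v\<in>I \<rightarrow>\<^sub>E UNIV. f v j)) (I \<rightarrow>\<^sub>E UNIV)"
    by (rule has_sum_infsum)
  have "(\<Sum>v\<in>exponents I k. f v j) = (a gchoose k) * fps_nth (exp_sum I q b ^ k) j" for k
  proof -
    have "(\<Sum>v\<in>exponents I k. f v j) = fps_nth (\<Sum>v\<in>exponents I k.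
        fps_const (gen_multinomial a I v) * (\<Prod>i\<in>I. (fps_const (q i) * fps_exp (b i)) ^ v i)) j"
      unfolding prod_fps_exp_power[OF assms(1)] by (simp add: fps_sum_nth f_def)
    then show ?thesis
      unfolding sum_gen_multinomial_fps[OF assms(1)] by (simp add: exp_sum_def)
  qed
  then have "(\<lambda>k. (a gchoose k) * fps_nth (exp_sum I q b ^ k) j) sums (\<Sum>\<^sub>\<infinity>v\<in>I \<rightarrow>\<^sub>E UNIV. f v j)"
    using has_sum_exponents[OF assms(1) sum] by simp
  then show "summable (\<lambda>k. (a gchoose k) * fps_nth (exp_sum I q b ^ k) j)"
    and "((\<lambda>v. f v j) has_sum fps_nth (binomial_series a (exp_sum I q b)) j) (I \<rightarrow>\<^sub>E UNIV)"
    using sum by (simp_all add: sums_iff binomial_series_def)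
qed

lemma has_sum_sum:
  fixes f :: "'i \<Rightarrow> 'v \<Rightarrow> 'a::topological_comm_monoid_add"
  assumes "\<And>i. i \<in> J \<Longrightarrow> (f i has_sum s i) A"
  shows "((\<lambda>v. \<Sum>i\<in>J. f i v) has_sum (\<Sum>i\<in>J. s i)) A"
  using assms by (induction J rule: infinite_finite_induct) (auto intro: has_sum_add)

text \<open>A coefficient of a product is a finite Cauchy sum, so it commutes with the infinite sum
  over tuples.\<close>

lemma has_sum_multinomial_mult_fps:
  fixes q b :: "'i \<Rightarrow> complex"
  assumes "finite I" and "a \<in> \<nat> \<or> (\<Sum>i\<in>I. norm (q i)) < 1"
  shows "((\<lambda>v. gen_multinomial a I v * (\<Prod>i\<in>I. q i ^ v i) *
            fps_nth (F * fps_exp (\<Sum>i\<in>I. of_nat (v i) * b i)) N) has_sum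
          fps_nth (F * binomial_series a (exp_sum I q b)) N) (I \<rightarrow>\<^sub>E UNIV)"
proof -
  have "((\<lambda>v. \<Sum>j=0..N. fps_nth F j * (gen_multinomial a I v *
           ((\<Prod>i\<in>I. q i ^ v i) * fps_nth (fps_exp (\<Sum>i\<in>I. of_nat (v i) * b i)) (N - j)))) has_sum
        (\<Sum>j=0..N. fps_nth F j * fps_nth (binomial_series a (exp_sum I q b)) (N - j))) (I \<rightarrow>\<^sub>E UNIV)"
    by (intro has_sum_sum has_sum_cmult_right has_sum_multinomial_exp_sum assms)
  then show ?thesis
    by (simp add: fps_mult_nth sum_distrib_left mult_ac)
qed

lemma binomial_series_0: "binomial_series 0 T = 1"
proof (rule fps_ext)
  fix j
  have "(\<lambda>k. (0 gchoose k) * fps_nth (T ^ k) j) sums (\<Sum>k\<in>{0}. (0 gchoose k) * fps_nth (T ^ k) j)"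
    by (rule sums_finite) (auto simp: gbinomial_0_left)
  then show "fps_nth (binomial_series 0 T) j = fps_nth 1 j"
    by (simp add: binomial_series_def sums_iff)
qed

text \<open>Pascal's rule for \<open>a gchoose k\<close>, applied termwise in each
  coefficient.\<close>

lemma binomial_series_Suc:
  assumes "\<And>j. summable (\<lambda>k. (a gchoose k) * fps_nth (T ^ k) j)"
  shows "binomial_series (a + 1) T = (1 + T) * binomial_series a T"
proof (rule fps_ext)
  fix j
  let ?H = "binomial_series a T"
  have H: "(\<lambda>k. (a gchoose k) * fps_nth (T ^ k) j) sums fps_nth ?H j" for j
    using assms by (simp add: binomial_series_def summable_sums)
  have "(\<lambda>k. \<Sum>i=0..j. fps_nth T i * ((a gchoose k) * fps_nth (T ^ k) (j - i))) sums
      (\<Sum>i=0..j. fps_nth T i * fps_nth ?H (j - i))"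
    by (intro sums_sum sums_mult H)
  then have TH: "(\<lambda>k. (a gchoose k) * fps_nth (T ^ Suc k) j) sums fps_nth (T * ?H) j"
    by (simp add: fps_mult_nth sum_distrib_left mult_ac)
  \<comment> \<open>The \<open>k = 0\<close> term, the coefficient of \<open>T ^ 0 = 1\<close>, is
    split off because Pascal's rule only covers \<open>Suc k\<close>; it is restored at the
    end.\<close>
  have "(\<lambda>k. (a gchoose Suc k) * fps_nth (T ^ Suc k) j) sums (fps_nth ?H j - fps_nth 1 j)"
    using H[of j] sums_Suc_iff[of "\<lambda>k. (a gchoose k) * fps_nth (T ^ k) j" "fps_nth ?H j - fps_nth 1 j"]
    by simp
  from sums_add[OF TH this]
  have "(\<lambda>k. ((a + 1) gchoose Suc k) * fps_nth (T ^ Suc k) j) sums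
      (fps_nth (T * ?H) j + (fps_nth ?H j - fps_nth 1 j))"
    by (simp only: gbinomial_Suc_Suc ring_distribs)
  then have "(\<lambda>k. ((a + 1) gchoose k) * fps_nth (T ^ k) j) sums
      (fps_nth (T * ?H) j + (fps_nth ?H j - fps_nth 1 j) + fps_nth 1 j)"
    using sums_Suc_iff[of "\<lambda>k. ((a + 1) gchoose k) * fps_nth (T ^ k) j"] by simp
  then show "fps_nth (binomial_series (a + 1) T) j = fps_nth ((1 + T) * ?H) j"
    by (simp add: binomial_series_def sums_iff ring_distribs)
qed

lemma binomial_series_of_nat:
  assumes "finite I"
  shows "binomial_series (of_nat n) (exp_sum I q b) = (1 + exp_sum I q b) ^ n"
proof (induction n)
  case (Suc n)
  have "binomial_series (of_nat n + 1) (exp_sum I q b) =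
      (1 + exp_sum I q b) * binomial_series (of_nat n) (exp_sum I q b)"
    by (rule binomial_series_Suc, rule has_sum_multinomial_exp_sum) (use assms in auto)
  then show ?case using Suc by (simp add: add.commute)
qed (simp add: binomial_series_0)

text \<open>The same recursion run downwards: passing from \<open>-n\<close> to
  \<open>-(n + 1)\<close> is compensated by one more factor \<open>1 + T\<close>.\<close>

lemma binomial_series_minus_of_nat:
  assumes "finite I" "(\<Sum>i\<in>I. norm (q i)) < 1"
  shows "binomial_series (- of_nat n) (exp_sum I q b) * (1 + exp_sum I q b) ^ n = 1"
proof (induction n)
  case (Suc n)
  have "binomial_series (- of_nat (Suc n) + 1) (exp_sum I q b) =
      (1 + exp_sum I q b) * binomial_series (- of_nat (Suc n)) (exp_sum I q b)"
    by (rule binomial_series_Suc, rule has_sum_multinomial_exp_sum) (use assms in auto)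
  then show ?case using Suc by (simp add: mult_ac)
qed (simp add: binomial_series_0)

section \<open>Divergence of the multinomial series\<close>

lemma gbinomial_Suc_eq: "a gchoose Suc k = (a gchoose k) * (a - of_nat k) / of_nat (Suc k)"
  for a :: "'a::field_char_0"
proof -
  have "of_nat (Suc k) * (a gchoose Suc k) = (a gchoose k) * (a - of_nat k)"
    using gbinomial_absorption[of k a] gbinomial_absorb_comp[of a k] by (simp add: mult.commute)
  then show ?thesis by (simp add: field_simps del: of_nat_Suc)
qed

text \<open>The ratio of consecutive terms is \<open>norm (a - of_nat k) * s / real (Suc k)\<close>,
  at least 1 from \<open>K\<close> on, and no term vanishes since \<open>a\<close> is not a natural
  number.\<close>

lemma gbinomial_power_not_tendsto_0:
  fixes a :: complex
  assumes "a \<notin> \<nat>" and "s > 0" and "\<And>k. k \<ge> K \<Longrightarrow> real (Suc k) \<le> norm (a - of_nat k) * s"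
  shows "\<not> (\<lambda>k. norm (a gchoose k) * s ^ k) \<longlonglongrightarrow> 0"
proof
  let ?u = "\<lambda>k. norm (a gchoose k) * s ^ k"
  assume lim: "?u \<longlonglongrightarrow> 0"
  have "a gchoose k \<noteq> 0" for k
  proof (induction k)
    case (Suc k)
    have "a \<noteq> of_nat k" using assms(1) by auto
    with Suc show ?case by (simp add: gbinomial_Suc_eq del: of_nat_Suc)
  qed simp
  then have pos: "?u K > 0" using assms(2) by simp
  have step: "?u k \<le> ?u (Suc k)" if "k \<ge> K" for k
  proof -
    have "?u (Suc k) = ?u k * (norm (a - of_nat k) * s / real (Suc k))"
      by (simp add: gbinomial_Suc_eq norm_mult norm_divide norm_of_nat mult_ac del: of_nat_Suc)
    moreover have "norm (a - of_nat k) * s / real (Suc k) \<ge> 1"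
      using assms(3)[OF that] by (simp add: field_simps)
    ultimately show ?thesis
      using mult_left_mono[of 1 "norm (a - of_nat k) * s / real (Suc k)" "?u k"] assms(2)
      by simp
  qed
  have "?u K \<le> ?u k" if "k \<ge> K" for k
    using that by (induction k rule: dec_induct) (use step in force)+
  then have "?u K \<le> 0"
    by (intro LIMSEQ_le_const[OF lim]) blast
  with pos show False by simp
qed

text \<open>As a function of \<open>y\<close>, the coefficient is a polynomial of degree
  \<open>N\<close> with leading coefficient \<open>fps_nth F 0 / fact N\<close>: a nonzero constant,
  or unbounded as \<open>y\<close> tends to infinity.\<close>

lemma fps_mult_exp_nth_bounded_below:
  fixes F :: "complex fps"
  assumes "fps_nth F 0 \<noteq> 0"
  obtains c R where "c > 0" "\<And>y. norm y \<ge> R \<Longrightarrow> norm (fps_nth (F * fps_exp y) N) \<ge> c"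
proof -
  define p where "p = (\<Sum>j\<le>N. monom (fps_nth F (N - j) / fact j) j)"
  have "poly p y = fps_nth (fps_exp y * F) N" for y
    unfolding fps_mult_nth by (simp add: p_def poly_sum poly_monom atLeast0AtMost mult_ac)
  then have poly_p: "poly p y = fps_nth (F * fps_exp y) N" for y
    by (simp only: mult.commute)
  have "coeff p N = fps_nth F 0 / fact N"
    by (simp add: p_def coeff_sum)
  then have "p \<noteq> 0" using assms by auto
  obtain a p' where p: "p = pCons a p'" by (cases p)
  show ?thesis
  proof (cases "p' = 0")
    case True
    then show ?thesis
      using \<open>p \<noteq> 0\<close> by (intro that[of "norm a" 0]) (auto simp: p simp flip: poly_p)
  next
    case False
    from poly_infinity[OF this, of 1 a] show ?thesis
      using that[of 1] by (auto simp: p simp flip: poly_p simp del: poly_pCons)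
  qed
qed

text \<open>On layer \<open>k\<close> the argument of the exponential is at least
  \<open>k * \<delta>\<close>, so for large \<open>k\<close> the coefficient factor has norm at
  least \<open>c\<close>. The layer of norms then dominates \<open>c\<close> times a sequence that
  does not tend to 0.\<close>

lemma not_summable_multinomial_mult_fps:
  fixes q :: "'i \<Rightarrow> complex" and b :: "'i \<Rightarrow> real"
  assumes "finite I" and b: "\<delta> > 0" "\<And>i. i \<in> I \<Longrightarrow> b i \<ge> \<delta>"
    and F: "fps_nth F 0 \<noteq> 0" and a: "a \<notin> \<nat>"
    and s: "(\<Sum>i\<in>I. norm (q i)) > 0"
      "\<And>k. k \<ge> K \<Longrightarrow> real (Suc k) \<le> norm (a - of_nat k) * (\<Sum>i\<in>I. norm (q i))"
  shows "\<not> (\<lambda>v. gen_multinomial a I v * (\<Prod>i\<in>I. q i ^ v i) *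
           fps_nth (F * fps_exp (\<Sum>i\<in>I. of_nat (v i) * of_real (b i))) N) summable_on (I \<rightarrow>\<^sub>E UNIV)"
    (is "\<not> ?f summable_on _")
proof
  assume "?f summable_on (I \<rightarrow>\<^sub>E UNIV)"
  \<comment> \<open>For complex terms unordered summability is already absolute, so cancellation
    cannot rescue convergence.\<close>
  then have "(\<lambda>v. norm (?f v)) summable_on (I \<rightarrow>\<^sub>E UNIV)"
    by (simp add: summable_on_iff_abs_summable_on_complex)
  then have "(\<lambda>k. \<Sum>v\<in>exponents I k. norm (?f v)) sums (\<Sum>\<^sub>\<infinity>v\<in>I \<rightarrow>\<^sub>E UNIV. norm (?f v))"
    by (intro has_sum_exponents assms has_sum_infsum)
  then have lim: "(\<lambda>k. \<Sum>v\<in>exponents I k. norm (?f v)) \<longlonglongrightarrow> 0"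
    by (intro summable_LIMSEQ_zero sums_summable)
  let ?s = "\<Sum>i\<in>I. norm (q i)"
  obtain c R where c: "c > 0"
    and cR: "\<And>y. norm y \<ge> R \<Longrightarrow> norm (fps_nth (F * fps_exp y) N) \<ge> c"
    using fps_mult_exp_nth_bounded_below[OF F] by blast
  have bound: "norm (a gchoose k) * ?s ^ k \<le> (\<Sum>v\<in>exponents I k. norm (?f v)) / c"
    if k: "k \<ge> nat \<lceil>R / \<delta>\<rceil>" for k
  proof -
    have "c * (norm (a gchoose k) * ?s ^ k) =
        (\<Sum>v\<in>exponents I k. norm (gen_multinomial a I v) * (\<Prod>i\<in>I. norm (q i) ^ v i) * c)"
      by (simp add: sum_norm_gen_multinomial[OF assms(1), symmetric] sum_distrib_left mult_ac)
    also have "\<dots> \<le> (\<Sum>v\<in>exponents I k. norm (?f v))"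
    proof (rule sum_mono)
      fix v assume v: "v \<in> exponents I k"
      let ?y = "\<Sum>i\<in>I. real (v i) * b i"
      have "R \<le> real k * \<delta>"
        using k b(1) by (simp add: nat_le_iff ceiling_le_iff pos_divide_le_eq)
      also have "\<dots> = (\<Sum>i\<in>I. real (v i) * \<delta>)"
        using v by (auto simp: exponents_def simp flip: sum_distrib_right of_nat_sum)
      also have "\<dots> \<le> ?y"
        by (intro sum_mono mult_left_mono b) auto
      also have "\<dots> \<le> norm (of_real ?y :: complex)"
        by (simp only: norm_of_real abs_ge_self)
      finally have "norm (fps_nth (F * fps_exp (of_real ?y)) N) \<ge> c"
        by (rule cR)
      then have "norm (gen_multinomial a I v) * (\<Prod>i\<in>I. norm (q i) ^ v i) * c \<le>
          norm (gen_multinomial a I v) * (\<Prod>i\<in>I. norm (q i) ^ v i) *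
          norm (fps_nth (F * fps_exp (of_real ?y)) N)"
        by (intro mult_left_mono) (auto intro!: mult_nonneg_nonneg prod_nonneg)
      then show "norm (gen_multinomial a I v) * (\<Prod>i\<in>I. norm (q i) ^ v i) * c \<le> norm (?f v)"
        by (simp add: norm_mult norm_power prod_norm[symmetric])
    qed
    finally show ?thesis using c by (simp add: field_simps)
  qed
  have "(\<lambda>k. norm (a gchoose k) * ?s ^ k) \<longlonglongrightarrow> 0"
  proof (rule tendsto_sandwich[OF _ _ tendsto_const])
    show "(\<lambda>k. (\<Sum>v\<in>exponents I k. norm (?f v)) / c) \<longlonglongrightarrow> 0"
      using tendsto_divide[OF lim tendsto_const[of c]] c by simp
    show "\<forall>\<^sub>F k in sequentially. norm (a gchoose k) * ?s ^ k \<le> (\<Sum>v\<in>exponents I k. norm (?f v)) / c"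
      using bound by (rule eventually_sequentiallyI)
    show "\<forall>\<^sub>F k in sequentially. 0 \<le> norm (a gchoose k) * ?s ^ k"
      using s(1) by (auto intro!: always_eventually mult_nonneg_nonneg)
  qed
  with gbinomial_power_not_tendsto_0[OF a s] show False by blast
qed

section \<open>Complex powers and the multiplication formula for the base\<close>

lemma fps_cpow_add:
  assumes "fps_nth U 0 \<noteq> 0"
  shows "fps_cpow U (a + b) = fps_cpow U a * fps_cpow U b"
proof -
  let ?V = "fps_const (inverse (fps_nth U 0)) * U - 1"
  have V0: "fps_nth ?V 0 = 0" using assms by simp
  show ?thesis
    unfolding fps_cpow_def fps_binomial_add_mult fps_compose_mult_distrib[OF V0] powr_add
    by (simp add: fps_const_mult[symmetric] mult_ac del: fps_const_mult)
qed

lemma fps_cpow_minus_of_nat: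
  assumes "fps_nth U 0 \<noteq> 0"
  shows "fps_cpow U (- of_nat p) * U ^ p = 1"
proof -
  have "fps_cpow U (- of_nat p) * U ^ p = fps_cpow U (- of_nat p + of_nat p)"
    unfolding fps_cpow_add[OF assms] fps_cpow_of_nat[OF assms] ..
  also have "\<dots> = fps_cpow U (of_nat 0)" by simp
  also have "\<dots> = 1" unfolding fps_cpow_of_nat[OF assms] by simp
  finally show ?thesis .
qed

lemma fps_cpow_nth_0:
  assumes "fps_nth U 0 \<noteq> 0"
  shows "fps_nth (fps_cpow U a) 0 \<noteq> 0"
  using assms by (simp add: fps_cpow_def)

text \<open>Substitutes \<open>z / m\<close> for \<open>z\<close>, with the denominator written as
  one minus the ratio of the geometric sum used next.\<close>

lemma genocchi_base_scaled:
  assumes "m > 0"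
  defines "c \<equiv> fps_const (1 / of_nat m) * fps_X"
  shows "(genocchi_base l oo c) * (1 - fps_const (- l) * fps_exp (1 / of_nat m)) =
    fps_const 2 * c"
proof -
  have c0: "fps_nth c 0 = 0" by (simp add: c_def)
  have "(genocchi_base l * (fps_const l * fps_exp 1 + 1)) oo c = (fps_const 2 * fps_X) oo c"
    by (simp only: genocchi_base_mult)
  then show ?thesis
    by (simp add: fps_compose_mult_distrib[OF c0] fps_compose_add_distrib
        fps_X_fps_compose_startby0[OF c0] add.commute)
      (simp add: c_def add.commute fps_const_neg[symmetric] del: fps_const_neg)
qed

text \<open>The two sides are compared after multiplication by \<open>1 - ?E\<close>, which can be
  cancelled because it divides the nonzero denominator \<open>?D\<close>. Oddness of
  \<open>m\<close> supplies the sign in \<open>?D\<close>.\<close>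

lemma genocchi_base_multiplication:
  fixes l :: complex
  assumes "odd m"
  defines "c \<equiv> fps_const (1 / of_nat m) * fps_X"
    and "T \<equiv> exp_sum {1..<m} (\<lambda>i. (- l) ^ i) (\<lambda>i. of_real (real i / real m))"
  shows "genocchi_base (l ^ m) * (1 + T) = fps_const (of_nat m) * (genocchi_base l oo c)"
proof -
  let ?E = "fps_const (- l) * fps_exp (1 / of_nat m)"
  let ?D = "fps_const (l ^ m) * fps_exp 1 + 1"
  have m: "m > 0" using assms(1) by (rule odd_pos)
  have pow: "?E ^ i = fps_const ((- l) ^ i) * fps_exp (of_real (real i / real m))" for i
    by (simp add: power_mult_distrib fps_const_power fps_exp_power_mult)
  have "{..<m} = insert 0 {1..<m}" using m by auto
  then have "1 + T = (\<Sum>i<m. ?E ^ i)"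
    by (simp add: T_def exp_sum_def pow)
  then have "(1 - ?E) * (1 + T) = 1 - ?E ^ m"
    by (simp add: one_diff_power_eq)
  also have "\<dots> = ?D"
    unfolding pow using m assms(1) by (simp add: fps_const_neg[symmetric] del: fps_const_neg)
  finally have D: "(1 - ?E) * (1 + T) = ?D" .
  then have nz: "1 - ?E \<noteq> 0" using genocchi_denom_nonzero[of "l ^ m"] by auto
  have "genocchi_base (l ^ m) * (1 + T) * (1 - ?E) = genocchi_base (l ^ m) * ?D"
    unfolding D[symmetric] by (simp only: mult_ac)
  also have "\<dots> = fps_const 2 * fps_X" by (rule genocchi_base_mult)
  also have "\<dots> = fps_const (of_nat m) * (fps_const 2 * c)"
    using m by (simp add: c_def mult.assoc[symmetric])
  also have "\<dots> = fps_const (of_nat m) * (genocchi_base l oo c) * (1 - ?E)"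
    using genocchi_base_scaled[OF m, of l, folded c_def] by (simp only: mult.assoc)
  finally show ?thesis using nz by (simp only: mult_cancel_right) simp
qed

text \<open>Here both bases have a simple zero. Cancelling it absorbs the factor \<open>m\<close>,
  since \<open>m\<close> times \<open>z / m\<close> is \<open>z\<close>.\<close>

lemma genocchi_unit_multiplication:
  fixes l :: complex
  assumes "odd m" "l ^ m \<noteq> -1"
  defines "c \<equiv> fps_const (1 / of_nat m) * fps_X"
    and "T \<equiv> exp_sum {1..<m} (\<lambda>i. (- l) ^ i) (\<lambda>i. of_real (real i / real m))"
  shows "unit_factor (genocchi_base (l ^ m)) * (1 + T) = unit_factor (genocchi_base l) oo c"
proof -
  have m: "m > 0" using assms(1) by (rule odd_pos)
  have c0: "fps_nth c 0 = 0" by (simp add: c_def)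
  have l: "l \<noteq> -1" using assms(1,2) by auto
  have dec: "genocchi_base k = unit_factor (genocchi_base k) * fps_X" if "k \<noteq> -1" for k
    using fps_unit_factor_decompose[of "genocchi_base k"] that
    by (simp add: subdegree_genocchi_base del: fps_unit_factor_def)
  have "unit_factor (genocchi_base (l ^ m)) * (1 + T) * fps_X = genocchi_base (l ^ m) * (1 + T)"
    by (subst (2) dec[OF assms(2)]) (simp only: mult_ac)
  also have "\<dots> = fps_const (of_nat m) * ((unit_factor (genocchi_base l) * fps_X) oo c)"
    unfolding c_def T_def genocchi_base_multiplication[OF assms(1)] dec[OF l, symmetric] ..
  also have "\<dots> = (unit_factor (genocchi_base l) oo c) * (fps_const (of_nat m) * c)"
    by (simp only: fps_compose_mult_distrib[OF c0] fps_X_fps_compose_startby0[OF c0] mult_ac)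
  also have "fps_const (of_nat m) * c = fps_X"
    using m by (simp add: c_def mult.assoc[symmetric])
  finally show ?thesis by (simp only: mult_cancel_right) simp
qed

section \<open>Integer orders and the multiplication theorem\<close>

lemma apostol_genocchi_of_nat:
  "apostol_genocchi (of_nat k) n x l = fact n * fps_nth (genocchi_base l ^ k * fps_exp x) n"
  by (simp flip: apostol_genocchi_gf_of_nat)

text \<open>The simple zero of the base contributes \<open>z\<close> to the power \<open>-p\<close>,
  which shifts the coefficient index from \<open>n\<close> to \<open>n + p\<close>.\<close>

lemma apostol_genocchi_minus_of_nat:
  assumes "l \<noteq> -1"
  shows "apostol_genocchi (- of_nat p) n x l = fact n *
    fps_nth (fps_cpow (unit_factor (genocchi_base l)) (- of_nat p) * fps_exp x) (n + p)"
proof -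
  have "{k. of_nat k + of_nat (subdegree (genocchi_base l)) * - of_nat p = (of_nat n :: complex)} =
      {n + p}"
    using assms by (auto simp: subdegree_genocchi_base diff_eq_eq simp flip: of_nat_add)
  then show ?thesis unfolding apostol_genocchi_def by simp
qed

lemma prod_power_weight:
  "(\<Prod>i=1..<m. (z ^ i) ^ v i) = z ^ (\<Sum>i=1..<m. i * v i)" for z :: "'a::comm_monoid_mult"
  by (simp add: power_sum power_mult)

lemma sum_weight_divide:
  "(\<Sum>i=1..<m. of_nat (v i) * of_real (real i / real m)) =
     (of_nat (\<Sum>i=1..<m. i * v i) / of_nat m :: complex)"
  by (simp add: sum_divide_distrib mult.commute)

theorem theorem2p1:
  fixes m n :: nat and \<alpha> l x :: complex
  assumes "odd m"
  shows "let V = {1..<m} \<rightarrow>\<^sub>E (UNIV :: nat set);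
             r = (\<lambda>v. \<Sum>i=1..<m. i * v i);
             t = (\<lambda>v. gen_multinomial \<alpha> {1..<m} v * (- l) ^ r v *
                      apostol_genocchi \<alpha> n (x + of_nat (r v) / of_nat m) (l ^ m))
         in (\<alpha> \<in> \<nat> \<or> (\<Sum>i=1..<m. norm l ^ i) < 1 \<longrightarrow> t summable_on V) \<and>
            (t summable_on V \<longrightarrow>
               apostol_genocchi \<alpha> n (of_nat m * x) l =
                 of_nat m powr (of_nat n - \<alpha>) * (\<Sum>\<^sub>\<infinity>v\<in>V. t v))"
proof -
  define I where "I = {1..<m}"
  define r where "r v = (\<Sum>i=1..<m. i * v i)" for v :: "nat \<Rightarrow> nat"
  define q where "q i = (- l) ^ i" for i :: nat
  define b where "b i = real i / real m" for i :: nat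
  define t where "t v = gen_multinomial \<alpha> I v * (- l) ^ r v *
      apostol_genocchi \<alpha> n (x + of_nat (r v) / of_nat m) (l ^ m)" for v
  define T where "T = exp_sum I q (\<lambda>i. of_real (b i))"
  define s where "s = (\<Sum>i=1..<m. norm l ^ i)"
  define c :: "complex fps" where "c = fps_const (1 / of_nat m) * fps_X"
  \<comment> \<open>The series \<open>F\<close> and the index \<open>N\<close> stay free:
    \<open>N\<close> is \<open>n\<close> for natural order or \<open>l ^ m = -1\<close>, and
    \<open>n + p\<close> for order \<open>-p\<close> otherwise.\<close>
  define f where "f F N v = gen_multinomial \<alpha> I v * (\<Prod>i\<in>I. q i ^ v i) *
      fps_nth (F * fps_exp (\<Sum>i\<in>I. of_nat (v i) * of_real (b i))) N" for F N v
  have m: "m > 0" using assms by (rule odd_pos)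
  have c0: "fps_nth c 0 = 0" by (simp add: c_def)
  have finI: "finite I" by (simp add: I_def)
  have s_eq: "(\<Sum>i\<in>I. norm (q i)) = s" by (simp add: I_def q_def s_def norm_power)
  have f_eq: "f (F * fps_exp x) N v = gen_multinomial \<alpha> I v * (- l) ^ r v *
      fps_nth (F * fps_exp (x + of_nat (r v) / of_nat m)) N" for F N v
    unfolding f_def I_def q_def b_def prod_power_weight sum_weight_divide r_def[symmetric]
    by (simp add: fps_exp_add_mult mult.assoc)
  have f_sum: "(f F N has_sum fps_nth (F * binomial_series \<alpha> T) N) (I \<rightarrow>\<^sub>E UNIV)"
    if "\<alpha> \<in> \<nat> \<or> s < 1" for F N
    unfolding f_def T_def by (rule has_sum_multinomial_mult_fps[OF finI]) (use that s_eq in simp)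
  have exp_c: "fps_exp x = fps_exp (of_nat m * x) oo c"
    using m by (simp add: c_def)

  have summable: "t summable_on (I \<rightarrow>\<^sub>E UNIV)" if "\<alpha> \<in> \<nat> \<or> s < 1"
  proof -
    let ?W = "fps_cpow (unit_factor (genocchi_base (l ^ m))) \<alpha>"
    let ?K = "{k. of_nat k + of_nat (subdegree (genocchi_base (l ^ m))) * \<alpha> = (of_nat n :: complex)}"
    have "(\<lambda>v. fact n * (\<Sum>k\<in>?K. f (?W * fps_exp x) k v)) summable_on (I \<rightarrow>\<^sub>E UNIV)"
      unfolding summable_on_def
      by (rule exI, rule has_sum_cmult_right, rule has_sum_sum, rule f_sum[OF that])
    also have "(\<lambda>v. fact n * (\<Sum>k\<in>?K. f (?W * fps_exp x) k v)) = t"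
      unfolding f_eq t_def apostol_genocchi_def
      by (simp add: sum_distrib_left mult_ac del: fps_unit_factor_def)
    finally show ?thesis .
  qed

  have not_summable: "\<not> (\<lambda>v. fact n * f F N v) summable_on (I \<rightarrow>\<^sub>E UNIV)"
    if "\<alpha> \<notin> \<nat>" "fps_nth F 0 \<noteq> 0" "s > 0"
      "\<And>k. k \<ge> K \<Longrightarrow> real (Suc k) \<le> norm (\<alpha> - of_nat k) * s" for F N K
  proof -
    have "\<not> f F N summable_on (I \<rightarrow>\<^sub>E UNIV)"
      unfolding f_def
    \<comment> \<open>The least exponent \<open>b i\<close> is \<open>1 / m\<close>, at
      \<open>i = 1\<close>.\<close>
    proof (rule not_summable_multinomial_mult_fps[where \<delta> = "1 / real m" and K = K])
      show "1 / real m \<le> b i" if "i \<in> I" for i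
        using that m by (auto simp: I_def b_def divide_right_mono)
    qed (use that m finI in \<open>simp_all add: s_eq\<close>)
    then show ?thesis by (subst summable_on_cmult_right') auto
  qed

  have identity: "apostol_genocchi \<alpha> n (of_nat m * x) l =
      of_nat m powr (of_nat n - \<alpha>) * (\<Sum>\<^sub>\<infinity>v\<in>I \<rightarrow>\<^sub>E UNIV. t v)"
    if t: "t summable_on (I \<rightarrow>\<^sub>E UNIV)"
  proof (cases "\<alpha> \<in> \<nat>")
    case True
    then obtain a where a: "\<alpha> = of_nat a" by (auto elim: Nats_cases)
    let ?B = "genocchi_base (l ^ m) ^ a" and ?G = "genocchi_base l ^ a * fps_exp (of_nat m * x)"
    have "t = (\<lambda>v. fact n * f (?B * fps_exp x) n v)"
      unfolding f_eq t_def by (simp add: a apostol_genocchi_of_nat mult_ac)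
    moreover have "((\<lambda>v. fact n * f (?B * fps_exp x) n v) has_sum
        fact n * fps_nth (?B * fps_exp x * binomial_series \<alpha> T) n) (I \<rightarrow>\<^sub>E UNIV)"
      by (intro has_sum_cmult_right f_sum disjI1 True)
    ultimately have t_sum: "(\<Sum>\<^sub>\<infinity>v\<in>I \<rightarrow>\<^sub>E UNIV. t v) =
        fact n * fps_nth (?B * fps_exp x * binomial_series \<alpha> T) n"
      by (simp add: infsumI)
    have "?B * fps_exp x * binomial_series \<alpha> T =
        (genocchi_base (l ^ m) * (1 + T)) ^ a * fps_exp x"
      unfolding a T_def binomial_series_of_nat[OF finI] by (simp only: power_mult_distrib mult_ac)
    also have "\<dots> = (fps_const (of_nat m) * (genocchi_base l oo c)) ^ a *
        (fps_exp (of_nat m * x) oo c)"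
      unfolding exp_c[symmetric]
      unfolding T_def I_def q_def b_def c_def genocchi_base_multiplication[OF assms] ..
    also have "\<dots> = fps_const (of_nat m ^ a) * (?G oo c)"
      by (simp only: power_mult_distrib fps_const_power fps_compose_power[OF c0]
          fps_compose_mult_distrib[OF c0] mult.assoc)
    finally have "fps_nth (?B * fps_exp x * binomial_series \<alpha> T) n =
        of_nat m ^ a * ((1 / of_nat m) ^ n * fps_nth ?G n)"
      by (simp add: c_def)
    moreover have "of_nat m powr (of_nat n - \<alpha>) * (of_nat m ^ a * (1 / of_nat m) ^ n) = (1 :: complex)"
      using m by (simp add: a powr_diff powr_nat power_divide)
    ultimately have "of_nat m powr (of_nat n - \<alpha>) *
        fps_nth (?B * fps_exp x * binomial_series \<alpha> T) n = fps_nth ?G n"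
      by (metis (no_types, lifting) mult.assoc mult_1)
    then show ?thesis
      unfolding t_sum by (simp add: a apostol_genocchi_of_nat mult.left_commute)
  next
    case False
    show ?thesis
    \<comment> \<open>With \<open>m = 1\<close> there is only the empty tuple and the identity is
      trivial. It is separated because divergence below needs \<open>s > 0\<close>.\<close>
    proof (cases "m = 1")
      case True
      then show ?thesis
        by (simp add: t_def I_def r_def gen_multinomial_def)
    next
      case m1: False
      then have m3: "m \<ge> 3" using assms by (cases m) (auto elim!: oddE)
      let ?W = "\<lambda>k. fps_cpow (unit_factor (genocchi_base k)) \<alpha>"
      have U0: "fps_nth (unit_factor (genocchi_base k)) 0 \<noteq> 0" for k
        by (rule fps_unit_factor_nth_0[OF genocchi_base_nonzero])
      have W0: "fps_nth (?W k * fps_exp x) 0 \<noteq> 0" for k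
        using fps_cpow_nth_0[OF U0] by (simp del: fps_unit_factor_def)
      show ?thesis
      proof (cases "l ^ m = -1")
        case True
        have "norm l ^ m = 1" using True by (metis norm_minus_cancel norm_one norm_power)
        then have "norm l = 1" using m power_eq_imp_eq_base[of "norm l" m 1] by simp
        then have s: "s = real (m - 1)" by (simp add: s_def)
        have "t = (\<lambda>v. fact n * f (?W (l ^ m) * fps_exp x) n v)"
          unfolding f_eq t_def
          by (simp add: apostol_genocchi_def True subdegree_genocchi_base mult_ac del: fps_unit_factor_def)
        moreover have "\<not> (\<lambda>v. fact n * f (?W (l ^ m) * fps_exp x) n v) summable_on (I \<rightarrow>\<^sub>E UNIV)"
        \<comment> \<open>Here \<open>s = m - 1\<close> is at least 2, and \<open>K\<close> is
          chosen so that \<open>2 * (k - norm \<alpha>)\<close> is at least \<open>k + 1\<close> for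
          \<open>k\<close> from \<open>K\<close> on.\<close>
        proof (rule not_summable[OF False W0, where K = "nat \<lceil>2 * norm \<alpha> + 1\<rceil>"])
          show "s > 0" using s m3 by simp
          fix k assume "k \<ge> nat \<lceil>2 * norm \<alpha> + 1\<rceil>"
          then have "2 * norm \<alpha> + 1 \<le> real k"
            using order_trans[OF real_nat_ceiling_ge of_nat_mono] by blast
          then have "real (Suc k) \<le> (real k - norm \<alpha>) * 2"
            by simp
          also have "\<dots> \<le> norm (\<alpha> - of_nat k) * s"
            using norm_triangle_ineq2[of "of_nat k" \<alpha>] m3
            by (intro mult_mono) (simp_all add: s norm_minus_commute)
          finally show "real (Suc k) \<le> norm (\<alpha> - of_nat k) * s" .
        qed
        ultimately show ?thesis using t by simp
      next
        case L: False
        then have l: "l \<noteq> -1" using assms by auto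
        show ?thesis
        proof (cases "\<exists>k. of_nat k + \<alpha> = of_nat n")
          case no_index: False
          then have "apostol_genocchi \<alpha> n y l' = 0" if "l' \<noteq> -1" for y l'
            using that by (simp add: apostol_genocchi_def subdegree_genocchi_base)
          then show ?thesis using l L by (simp add: t_def)
        next
          case True
          then obtain k where k: "\<alpha> = of_nat n - of_nat k" by (auto simp: eq_diff_eq add.commute)
          have "\<not> k \<le> n" using False by (auto simp: k simp flip: of_nat_diff)
          then obtain p where p: "k = n + p" "p > 0" by (metis less_imp_add_positive not_le)
          have \<alpha>: "\<alpha> = - of_nat p" by (simp add: k p)
          have t_eq: "t = (\<lambda>v. fact n * f (?W (l ^ m) * fps_exp x) (n + p) v)"
            unfolding f_eq t_def unfolding \<alpha> apostol_genocchi_minus_of_nat[OF L]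
            by (simp add: mult_ac)
          have "s < 1"
          proof (rule ccontr)
            assume s: "\<not> s < 1"
            \<comment> \<open>For \<open>\<alpha> = -p\<close> the distance to \<open>k\<close> is
              \<open>p + k\<close>, at least \<open>k + 1\<close>, so the ratio bound already holds
              from \<open>k = 0\<close>.\<close>
            have "real (Suc k) \<le> norm (\<alpha> - of_nat k) * s" for k
            proof -
              have "norm (\<alpha> - of_nat k) = norm (of_nat (p + k) :: complex)"
                by (simp only: \<alpha> minus_diff_commute of_nat_add norm_minus_cancel
                    diff_conv_add_uminus minus_add_distrib[symmetric])
              then have "norm (\<alpha> - of_nat k) = real (p + k)"
                by (simp only: norm_of_nat)
              moreover have "real (Suc k) * 1 \<le> real (p + k) * s"
                using p s by (intro mult_mono) auto
              ultimately show ?thesis by simp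
            qed
            then show False
              using not_summable[OF False W0, of 0] s t unfolding t_eq by fastforce
          qed
          let ?G = "?W l * fps_exp (of_nat m * x)"
          let ?H = "binomial_series \<alpha> T"
          have "?W (l ^ m) * ?H = ?W l oo c"
          proof -
            \<comment> \<open>Both series are shown to be inverse to the same \<open>?S\<close>; no
              additivity of complex powers in the base is required.\<close>
            let ?S = "(unit_factor (genocchi_base (l ^ m)) * (1 + T)) ^ p"
            have "?W (l ^ m) * ?H * ?S =
                (?W (l ^ m) * unit_factor (genocchi_base (l ^ m)) ^ p) * (?H * (1 + T) ^ p)"
              by (simp only: power_mult_distrib mult_ac)
            also have "\<dots> = 1"
              using fps_cpow_minus_of_nat[OF U0] binomial_series_minus_of_nat[OF finI, of q]
                \<open>s < 1\<close> by (simp add: \<alpha> T_def s_eq del: fps_unit_factor_def)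
            finally have 1: "?W (l ^ m) * ?H * ?S = 1" .
            have "?S = (unit_factor (genocchi_base l) oo c) ^ p"
              unfolding T_def I_def q_def b_def c_def genocchi_unit_multiplication[OF assms L] ..
            then have "(?W l oo c) * ?S = (?W l * unit_factor (genocchi_base l) ^ p) oo c"
              by (simp only: fps_compose_power[OF c0] fps_compose_mult_distrib[OF c0])
            also have "\<dots> = 1"
              unfolding \<alpha> fps_cpow_minus_of_nat[OF U0] by simp
            finally have 2: "(?W l oo c) * ?S = 1" .
            from 1 2 show ?thesis by (metis mult_cancel_right zero_neq_one mult_zero_right)
          qed
          then have "?W (l ^ m) * fps_exp x * ?H = ?G oo c"
            unfolding fps_compose_mult_distrib[OF c0] exp_c[symmetric] by (simp only: mult_ac)
          moreover have "(\<Sum>\<^sub>\<infinity>v\<in>I \<rightarrow>\<^sub>E UNIV. t v) =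
              fact n * fps_nth (?W (l ^ m) * fps_exp x * ?H) (n + p)"
            unfolding t_eq by (intro infsumI has_sum_cmult_right f_sum disjI2 \<open>s < 1\<close>)
          ultimately have "(\<Sum>\<^sub>\<infinity>v\<in>I \<rightarrow>\<^sub>E UNIV. t v) =
              fact n * ((1 / of_nat m) ^ (n + p) * fps_nth ?G (n + p))"
            by (simp add: c_def del: fps_unit_factor_def)
          \<comment> \<open>This power cancels the scaling factor that the substitution
            \<open>z / m\<close> produces at coefficient \<open>n + p\<close>.\<close>
          moreover have "of_nat m powr (of_nat n - \<alpha>) = (of_nat m ^ (n + p) :: complex)"
            using m by (simp add: \<alpha> powr_nat' flip: of_nat_add)
          moreover have "apostol_genocchi \<alpha> n (of_nat m * x) l = fact n * fps_nth ?G (n + p)"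
            unfolding \<alpha> by (rule apostol_genocchi_minus_of_nat[OF l])
          ultimately show ?thesis
            using m by (simp add: power_divide del: fps_unit_factor_def)
        qed
      qed
    qed
  qed
  show ?thesis
    using summable identity
    unfolding Let_def I_def t_def s_def r_def by blast
qed

end
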